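(* For nonnegative integers $n,m$, $$\sum_{r=0}^{n}\sum_{s=0}^{m}(-1)^{r+s}\binom{n}{r}\binom{m}{s}K_2[a,a,a,a;-r,-r,-s,-r;e_1,e_2,e_3,e_4;x,y,z,u]$$ $$=\frac{(a)_{m+n}}{(e_1)_n(e_3)_m}\,F_4\left[-n,1-e_1-n;e_2,e_4;\frac{y}{x},\frac{u}{x}\right].$$
   Context: $(\lambda)_k=\lambda(\lambda+1)\cdots(\lambda+k-1)$, $(\lambda)_0=1$, is the Pochhammer symbol. Exton's quadruple hypergeometric function $K_2$, with parameters $a,b,c,e_1,e_2,e_3,e_4$ and variables $x,y,z,u$, is $$K_2[a,a,a,a;b,b,c,b;e_1,e_2,e_3,e_4;x,y,z,u]=\sum_{i,j,p,q=0}^{\infty}\frac{(a)_{i+j+p+q}(b)_{i+j+q}(c)_p}{(e_1)_i(e_2)_j(e_3)_p(e_4)_q}\frac{x^i}{i!}\frac{y^j}{j!}\frac{z^p}{p!}\frac{u^q}{q!};$$ in the claim it is taken with $b=-r$ and $c=-s$. Appell's hypergeometric function $F_4$ is $$F_4[\alpha,\beta;\gamma,\gamma';X,Y]=\sum_{j,k=0}^{\infty}\frac{(\alpha)_{j+k}(\beta)_{j+k}}{(\gamma)_j(\gamma')_k}\frac{X^j}{j!}\frac{Y^k}{k!}.$$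
   Formalization: The right-hand side is multiplied by x^n z^m, which the printed identity omits; as printed it fails, e.g. for n=0, m=1, a=e_3=1, z=2 (left side 2, right side 1). *)

theory Defs
  imports "HOL-Analysis.Analysis"
begin

text \<open>
  Both series are unordered sums over all index tuples; \<^term>\<open>infsum\<close> yields 0 for a series
  that is not summable. The lemmas below show that the instances with nonpositive integer
  numerator parameters terminate, so for them this default value plays no role.
\<close>

definition exton_K2_term ::
  "complex \<Rightarrow> complex \<Rightarrow> complex \<Rightarrow> complex \<Rightarrow> complex \<Rightarrow> complex \<Rightarrow> complex \<Rightarrow>
   complex \<Rightarrow> complex \<Rightarrow> complex \<Rightarrow> complex \<Rightarrow> nat \<times> nat \<times> nat \<times> nat \<Rightarrow> complex" where
  "exton_K2_term a b c e1 e2 e3 e4 x y z u = (\<lambda>(i, j, p, q).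
     (pochhammer a (i + j + p + q) * pochhammer b (i + j + q) * pochhammer c p) /
     (pochhammer e1 i * pochhammer e2 j * pochhammer e3 p * pochhammer e4 q) *
     (x ^ i / fact i) * (y ^ j / fact j) * (z ^ p / fact p) * (u ^ q / fact q))"

text \<open>\<open>K\<^sub>2[a,a,a,a; b,b,c,b; e\<^sub>1,e\<^sub>2,e\<^sub>3,e\<^sub>4; x,y,z,u]\<close>\<close>

definition exton_K2 ::
  "complex \<Rightarrow> complex \<Rightarrow> complex \<Rightarrow> complex \<Rightarrow> complex \<Rightarrow> complex \<Rightarrow> complex \<Rightarrow>
   complex \<Rightarrow> complex \<Rightarrow> complex \<Rightarrow> complex \<Rightarrow> complex" where
  "exton_K2 a b c e1 e2 e3 e4 x y z u =
     infsum (exton_K2_term a b c e1 e2 e3 e4 x y z u) UNIV"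

definition appell_F4_term ::
  "complex \<Rightarrow> complex \<Rightarrow> complex \<Rightarrow> complex \<Rightarrow> complex \<Rightarrow> complex \<Rightarrow> nat \<times> nat \<Rightarrow> complex" where
  "appell_F4_term \<alpha> \<beta> \<gamma> \<gamma>' X Y = (\<lambda>(j, k).
     (pochhammer \<alpha> (j + k) * pochhammer \<beta> (j + k)) / (pochhammer \<gamma> j * pochhammer \<gamma>' k) *
     (X ^ j / fact j) * (Y ^ k / fact k))"

definition appell_F4 ::
  "complex \<Rightarrow> complex \<Rightarrow> complex \<Rightarrow> complex \<Rightarrow> complex \<Rightarrow> complex \<Rightarrow> complex" where
  "appell_F4 \<alpha> \<beta> \<gamma> \<gamma>' X Y = infsum (appell_F4_term \<alpha> \<beta> \<gamma> \<gamma>' X Y) UNIV"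

lemma exton_K2_term_terminates:
  assumes "exton_K2_term a (- of_nat r) (- of_nat s) e1 e2 e3 e4 x y z u (i, j, p, q) \<noteq> 0"
  shows "i + j + q \<le> r \<and> p \<le> s"
  using assms by (auto simp: exton_K2_term_def pochhammer_of_nat_eq_0_iff not_le)

lemma exton_K2_terminating_summable:
  "exton_K2_term a (- of_nat r) (- of_nat s) e1 e2 e3 e4 x y z u summable_on UNIV"
proof -
  let ?f = "exton_K2_term a (- of_nat r) (- of_nat s) e1 e2 e3 e4 x y z u"
  let ?A = "{..r} \<times> {..r} \<times> {..s} \<times> {..r}"
  have "?f t = 0" if "t \<notin> ?A" for t
    using that exton_K2_term_terminates[of a r s e1 e2 e3 e4 x y z u]
    by (cases t) fastforce
  moreover have "?f summable_on ?A"
    by (intro summable_on_finite) auto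
  ultimately show ?thesis
    by (subst summable_on_cong_neutral[where T = ?A and g = ?f]) auto
qed

lemma appell_F4_term_terminates:
  assumes "appell_F4_term (- of_nat n) \<beta> \<gamma> \<gamma>' X Y (j, k) \<noteq> 0"
  shows "j + k \<le> n"
  using assms by (auto simp: appell_F4_term_def pochhammer_of_nat_eq_0_iff not_le)

lemma appell_F4_terminating_summable:
  "appell_F4_term (- of_nat n) \<beta> \<gamma> \<gamma>' X Y summable_on UNIV"
proof -
  let ?f = "appell_F4_term (- of_nat n) \<beta> \<gamma> \<gamma>' X Y"
  let ?A = "{..n} \<times> {..n}"
  have "?f t = 0" if "t \<notin> ?A" for t
    using that appell_F4_term_terminates[of n \<beta> \<gamma> \<gamma>' X Y]
    by (cases t) fastforce
  moreover have "?f summable_on ?A"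
    by (intro summable_on_finite) auto
  ultimately show ?thesis
    by (subst summable_on_cong_neutral[where T = ?A and g = ?f]) auto
qed

text \<open>
  The source prints the summation formula without the factor \<open>x\<^sup>n z\<^sup>m\<close> on the right-hand side.
  It is false in that form: for \<open>n = 0\<close>, \<open>m = 1\<close> the left-hand side is
  \<open>1 - (1 - a z / e\<^sub>3) = a z / e\<^sub>3\<close>.
\<close>

end

theory Submission imports Defs
begin

text \<open>
  Since \<open>(- r)\<^sub>N = (- 1)\<^sup>N N! (r choose N)\<close>, summing \<open>(- r)\<^sub>N\<close> against
  \<open>(- 1)\<^sup>r (n choose r)\<close> is binomial inversion: the result vanishes unless \<open>N = n\<close>, when it is
  \<open>n!\<close> (\<open>alternating_binomial_pochhammer\<close>). In \<open>K\<^sub>2\<close> the parameter \<open>r\<close> enters only through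
  \<open>(- r)\<^bsub>i+j+q\<^esub>\<close> and \<open>s\<close> only through \<open>(- s)\<^sub>p\<close>, so the double sum over \<open>r, s\<close> extracts exactly
  the terms of the series with \<open>i + j + q = n\<close> and \<open>p = m\<close>.

  The surviving sum has the free indices \<open>j, q\<close>, with \<open>i = n - j - q\<close>. Reversing the two
  products that run in \<open>i\<close>, by \<open>n! / i! = (- 1)\<^sup>N (- n)\<^sub>N\<close> and
  \<open>(e\<^sub>1)\<^sub>n / (e\<^sub>1)\<^sub>i = (- 1)\<^sup>N (1 - e\<^sub>1 - n)\<^sub>N\<close> for \<open>N = j + q\<close>, makes it the terminating \<open>F\<^sub>4\<close> series.
  The first reversal is the second one at \<open>e\<^sub>1 = 1\<close> (\<open>pochhammer_split_reversed\<close>).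
\<close>

text \<open>
  With \<open>(n choose r) (r choose N) = (n choose N) (n - N choose r - N)\<close> the sum becomes an
  alternating row sum of Pascal's triangle, which is zero for every row but the top one.
\<close>

lemma alternating_binomial_pochhammer:
  "(\<Sum>r=0..n. (-1) ^ r * of_nat (n choose r) * pochhammer (- of_nat r) N) =
     (if N = n then fact n else (0 :: complex))"
proof (cases "N \<le> n")
  case False
  then show ?thesis
    by (auto simp: pochhammer_of_nat_eq_0_iff intro!: sum.neutral)
next
  case True
  let ?c = "fact N * of_nat (n choose N) :: complex"
  have poch: "pochhammer (- of_nat r) N = (-1) ^ N * fact N * (of_nat (r choose N) :: complex)" for r
    by (simp add: binomial_gbinomial gbinomial_pochhammer flip: power_mult_distrib mult.assoc)
  have "(\<Sum>r=0..n. (-1) ^ r * of_nat (n choose r) * pochhammer (- of_nat r) N) =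
        (\<Sum>r=N..n. (-1) ^ r * of_nat (n choose r) * pochhammer (- of_nat r) N :: complex)"
    by (rule sum.mono_neutral_right) (auto simp: poch)
  also have "\<dots> = (\<Sum>k\<le>n - N. ?c * ((-1) ^ k * of_nat ((n - N) choose k)))"
  proof (rule sum.reindex_bij_witness[of _ "\<lambda>k. k + N" "\<lambda>r. r - N"]; clarsimp)
    fix r assume r: "N \<le> r" "r \<le> n"
    have c: "of_nat (n choose r) * (of_nat (r choose N) :: complex) =
          of_nat (n choose N) * of_nat ((n - N) choose (r - N))"
      using choose_mult[OF r] by (simp flip: of_nat_mult)
    have sgn: "(-1 :: complex) ^ r * (-1) ^ N = (-1) ^ (r - N)"
      using r by (metis le_add_diff_inverse2 left_minus_one_mult_self mult.commute power_add)
    have "(-1) ^ r * of_nat (n choose r) * pochhammer (- (of_nat r :: complex)) N =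
        fact N * ((-1) ^ r * (-1) ^ N) * (of_nat (n choose r) * of_nat (r choose N))"
      by (simp add: poch mult_ac)
    then show "fact N * of_nat (n choose N) * ((-1) ^ (r - N) * of_nat ((n - N) choose (r - N))) =
        (-1) ^ r * of_nat (n choose r) * pochhammer (- (of_nat r :: complex)) N"
      unfolding c sgn by (simp only: mult_ac)
  qed (use True in auto)
  also have "\<dots> = ?c * (\<Sum>k\<le>n - N. (-1) ^ k * of_nat ((n - N) choose k))"
    by (simp add: sum_distrib_left)
  also have "\<dots> = (if N = n then fact n else 0)"
    using True choose_alternating_sum[of "n - N", where ?'a = complex] by auto
  finally show ?thesis .
qed

text \<open>
  The last \<open>N\<close> factors of \<open>(c)\<^bsub>i+N\<^esub>\<close>, read backwards with the sign of each changed, ascend from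
  \<open>1 - c - (i + N)\<close>.
\<close>

lemma pochhammer_split_reversed:
  fixes c :: "'a::comm_ring_1"
  shows "pochhammer c (i + N) = pochhammer c i * ((-1) ^ N * pochhammer (1 - c - of_nat (i + N)) N)"
proof -
  have "pochhammer (1 - c - of_nat (i + N)) N = (-1) ^ N * pochhammer (c + of_nat i) N"
    using pochhammer_minus[of "c + of_nat (i + N) - 1" N] by (simp add: algebra_simps)
  then show ?thesis
    by (simp add: pochhammer_product' flip: power_mult_distrib mult.assoc)
qed

text \<open>
  The box of indices is uniform in \<open>r \<le> n\<close> and \<open>s \<le> m\<close>, so that the sum over it can be exchanged
  with the sums over \<open>r\<close> and \<open>s\<close>.
\<close>

lemma exton_K2_eq_sum:
  assumes "r \<le> n" "s \<le> m"
  shows "exton_K2 a (- of_nat r) (- of_nat s) e1 e2 e3 e4 x y z u =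
    sum (exton_K2_term a (- of_nat r) (- of_nat s) e1 e2 e3 e4 x y z u)
      ({..n} \<times> {..n} \<times> {..m} \<times> {..n})"
proof -
  let ?f = "exton_K2_term a (- of_nat r) (- of_nat s) e1 e2 e3 e4 x y z u"
  let ?A = "{..n} \<times> {..n} \<times> {..m} \<times> {..n}"
  have "?f t = 0" if "t \<notin> ?A" for t
  proof (cases t)
    case (fields i j p q)
    then show ?thesis
      using exton_K2_term_terminates[of a r s e1 e2 e3 e4 x y z u i j p q] assms that by force
  qed
  then have "infsum ?f UNIV = infsum ?f ?A"
    by (intro infsum_cong_neutral) auto
  then show ?thesis
    by (simp add: exton_K2_def)
qed

lemma appell_F4_eq_sum:
  "appell_F4 (- of_nat n) \<beta> \<gamma> \<gamma>' X Y =
     sum (appell_F4_term (- of_nat n) \<beta> \<gamma> \<gamma>' X Y) {(j, k). j + k \<le> n}"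
proof -
  let ?f = "appell_F4_term (- of_nat n) \<beta> \<gamma> \<gamma>' X Y"
  have "?f t = 0" if "t \<notin> {(j, k). j + k \<le> n}" for t
    using that appell_F4_term_terminates[of n \<beta> \<gamma> \<gamma>' X Y] by (cases t) auto
  then have "infsum ?f UNIV = infsum ?f {(j, k). j + k \<le> n}"
    by (intro infsum_cong_neutral) auto
  moreover have "finite {(j, k). j + k \<le> n}"
    by (rule finite_subset[of _ "{..n} \<times> {..n}"]) auto
  ultimately show ?thesis
    by (simp add: appell_F4_def)
qed

lemma appell_F4_term_reversed:
  assumes e1: "e1 \<notin> \<int>\<^sub>\<le>\<^sub>0" and x: "x \<noteq> 0" and jq: "j + q \<le> n"
  shows "x ^ n / pochhammer e1 n *
      appell_F4_term (- of_nat n) (1 - e1 - of_nat n) e2 e4 (y / x) (u / x) (j, q) =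
    fact n / (pochhammer e1 (n - j - q) * pochhammer e2 j * pochhammer e4 q) *
      (x ^ (n - j - q) / fact (n - j - q)) * (y ^ j / fact j) * (u ^ q / fact q)"
proof -
  define i where "i = n - j - q"
  have n: "n = i + (j + q)"
    using jq by (simp add: i_def)
  define \<sigma> :: complex where "\<sigma> = (-1) ^ (j + q)"
  have \<sigma>: "\<sigma> = 1 \<or> \<sigma> = -1"
    by (simp add: \<sigma>_def minus_one_power_iff)
  let ?P = "pochhammer (1 - e1 - of_nat n) (j + q)"
  let ?Q = "pochhammer (- of_nat n :: complex) (j + q)"
  have "pochhammer e1 n \<noteq> 0"
    using e1 by (auto simp: pochhammer_eq_0_iff)
  moreover have e: "pochhammer e1 n = pochhammer e1 i * (\<sigma> * ?P)"
    using pochhammer_split_reversed[of e1 i "j + q"] n by (simp add: \<sigma>_def)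
  ultimately have nz: "pochhammer e1 i \<noteq> 0" "?P \<noteq> 0"
    by auto
  have f: "fact n = fact i * (\<sigma> * ?Q)"
    using pochhammer_split_reversed[of "1::complex" i "j + q"] n by (simp add: pochhammer_fact \<sigma>_def)
  have xn: "x ^ n = x ^ i * x ^ j * x ^ q"
    by (simp add: n power_add)
  show ?thesis
    unfolding appell_F4_term_def i_def[symmetric] prod.case e f xn power_divide
    using nz x \<sigma> by (elim disjE) (simp_all add: field_simps)
qed

theorem mainTheorem3:
  fixes n m :: nat and a e1 e2 e3 e4 x y z u :: complex
  assumes "e1 \<notin> \<int>\<^sub>\<le>\<^sub>0" and "e2 \<notin> \<int>\<^sub>\<le>\<^sub>0" and "e3 \<notin> \<int>\<^sub>\<le>\<^sub>0" and "e4 \<notin> \<int>\<^sub>\<le>\<^sub>0"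
    and "x \<noteq> 0"
  shows "(\<Sum>r=0..n. \<Sum>s=0..m. (-1) ^ (r + s) * of_nat (n choose r) * of_nat (m choose s) *
            exton_K2 a (- of_nat r) (- of_nat s) e1 e2 e3 e4 x y z u) =
         pochhammer a (m + n) / (pochhammer e1 n * pochhammer e3 m) * x ^ n * z ^ m *
           appell_F4 (- of_nat n) (1 - e1 - of_nat n) e2 e4 (y / x) (u / x)"
proof -
  let ?A = "{..n} \<times> {..n} \<times> {..m} \<times> {..n}"
  let ?w = "\<lambda>r s. (-1) ^ (r + s) * of_nat (n choose r) * of_nat (m choose s) :: complex"
  let ?F = "\<lambda>r s. exton_K2_term a (- of_nat r) (- of_nat s) e1 e2 e3 e4 x y z u"
  let ?S = "\<lambda>n N. \<Sum>r=0..n. (-1) ^ r * of_nat (n choose r) * pochhammer (- of_nat r) N :: complex"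
  define T where "T = (\<lambda>(i, j, p, q). pochhammer a (i + j + p + q) /
     (pochhammer e1 i * pochhammer e2 j * pochhammer e3 p * pochhammer e4 q) *
     (x ^ i / fact i) * (y ^ j / fact j) * (z ^ p / fact p) * (u ^ q / fact q))"
  have "(\<Sum>r=0..n. \<Sum>s=0..m. ?w r s * exton_K2 a (- of_nat r) (- of_nat s) e1 e2 e3 e4 x y z u) =
        (\<Sum>r=0..n. \<Sum>s=0..m. \<Sum>t\<in>?A. ?w r s * ?F r s t)"
    by (intro sum.cong refl) (simp add: exton_K2_eq_sum[of _ n _ m] sum_distrib_left)
  also have "\<dots> = (\<Sum>t\<in>?A. \<Sum>r=0..n. \<Sum>s=0..m. ?w r s * ?F r s t)"
    by (simp only: sum.swap[of _ ?A])
  also have "\<dots> = (\<Sum>(i, j, p, q)\<in>?A. T (i, j, p, q) * (?S n (i + j + q) * ?S m p))"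
  proof (rule sum.cong[OF refl], clarify)
    fix i j p q
    show "(\<Sum>r=0..n. \<Sum>s=0..m. ?w r s * ?F r s (i, j, p, q)) =
        T (i, j, p, q) * (?S n (i + j + q) * ?S m p)"
      unfolding sum_product unfolding sum_distrib_left
      by (intro sum.cong refl) (simp add: T_def exton_K2_term_def power_add)
  qed
  also have "\<dots> = (\<Sum>(i, j, p, q)\<in>?A. T (i, j, p, q) *
      ((if i + j + q = n then fact n else 0) * (if p = m then fact m else 0)))"
    by (simp only: alternating_binomial_pochhammer)
  also have "\<dots> = (\<Sum>(i, j, p, q)\<in>{(i, j, p, q). i + j + q = n \<and> p = m}.
      T (i, j, p, q) * (fact n * fact m))"
    by (rule sum.mono_neutral_cong_right) (auto split: if_splits)
  also have "\<dots> = (\<Sum>(j, q)\<in>{(j, q). j + q \<le> n}. T (n - j - q, j, m, q) * (fact n * fact m))"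
    by (rule sum.reindex_bij_witness[of _ "\<lambda>(j, q). (n - j - q, j, m, q)" "\<lambda>(i, j, p, q). (j, q)"])
       auto
  also have "\<dots> = (\<Sum>(j, q)\<in>{(j, q). j + q \<le> n}.
      pochhammer a (m + n) / pochhammer e3 m * z ^ m * (x ^ n / pochhammer e1 n *
        appell_F4_term (- of_nat n) (1 - e1 - of_nat n) e2 e4 (y / x) (u / x) (j, q)))"
  proof (intro sum.cong refl, clarify)
    fix j q assume jq: "j + q \<le> n"
    have a: "n - j - q + j + m + q = m + n"
      using jq by simp
    show "T (n - j - q, j, m, q) * (fact n * fact m) =
      pochhammer a (m + n) / pochhammer e3 m * z ^ m * (x ^ n / pochhammer e1 n *
        appell_F4_term (- of_nat n) (1 - e1 - of_nat n) e2 e4 (y / x) (u / x) (j, q))"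
      unfolding appell_F4_term_reversed[OF assms(1) assms(5) jq] T_def prod.case a
      by (simp add: field_simps)
  qed
  also have "\<dots> = pochhammer a (m + n) / (pochhammer e1 n * pochhammer e3 m) * x ^ n * z ^ m *
           appell_F4 (- of_nat n) (1 - e1 - of_nat n) e2 e4 (y / x) (u / x)"
    by (simp add: appell_F4_eq_sum sum_distrib_left case_prod_unfold mult_ac)
  finally show ?thesis .
qed

end
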